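(* Let $\mathcal{G}$ be a locally compact Hausdorff étale ample groupoid. Then $\mathcal{G}$ is purely infinite if and only if $\mathcal{G}$ is purely infinite in the sense of Matui.
   Context: Standing assumption: all groupoids have infinite unit space. $\mathcal{G}^{(0)}$ is the unit space, $s(\gamma)=\gamma^{-1}\gamma$, $r(\gamma)=\gamma\gamma^{-1}$; for $D\subset \mathcal G^{(0)}$, $\mathcal G D=\{\gamma: s(\gamma)\in D\}$. An open bisection is an open set $U\subset\mathcal G$ such that $s|_U$ and $r|_U$ are homeomorphisms onto open subsets of $\mathcal G^{(0)}$. $\mathcal G$ is ample if its topology has a basis of compact open bisections. For $K\subset\mathcal G^{(0)}$ compact and $V\subset\mathcal G^{(0)}$ open, $K\prec_{\mathcal G}V$ means there are open bisections $A_1,\dots,A_n$ with $K\subset\bigcup_i s(A_i)$ and with $r(A_1),\dots,r(A_n)$ pairwise disjoint subsets of $V$. For non-empty open $U,V\subset\mathcal G^{(0)}$, $U\prec_{\mathcal G,2}V$ means: for every compact $F\subset U$ there are disjoint non-empty open sets $O_1,O_2\subset V$ with $F\prec_{\mathcal G}O_1$ and $F\prec_{\mathcal G}O_2$. $\mathcal G$ is purely infinite if $O_1\prec_{\mathcal G,2}O_2$ for all non-empty open sets $O_1,O_2\subset\mathcal G^{(0)}$ with $O_1\subset r(\mathcal G O_2)$. $\mathcal G$ is purely infinite in the sense of Matui if for every compact open set $O\subset\mathcal G^{(0)}$ there are compact open bisections $U,V\subset\mathcal G$ with $s(U)=s(V)=O$, $r(U)\cap r(V)=\emptyset$ and $r(U)\cup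 r(V)\subset O$. *)

theory Defs
  imports "HOL-Analysis.Analysis"
begin

text \<open>
  The underlying set of a groupoid is the carrier \<^term>\<open>topspace\<close> of its topology;
  \<open>composable\<close> is the set of composable pairs, outside of which \<open>mul\<close> carries no meaning.
\<close>

record 'g topgroupoid =
  top_of :: "'g topology"
  composable :: "('g \<times> 'g) set"
  mul :: "'g \<Rightarrow> 'g \<Rightarrow> 'g"
  ginv :: "'g \<Rightarrow> 'g"

abbreviation arrows :: "'g topgroupoid \<Rightarrow> 'g set" where
  "arrows G \<equiv> topspace (top_of G)"

definition src :: "'g topgroupoid \<Rightarrow> 'g \<Rightarrow> 'g" where
  "src G x = mul G (ginv G x) x"

definition rng :: "'g topgroupoid \<Rightarrow> 'g \<Rightarrow> 'g" where
  "rng G x = mul G x (ginv G x)"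

definition units :: "'g topgroupoid \<Rightarrow> 'g set" where
  "units G = {mul G (ginv G x) x | x. x \<in> arrows G}"

abbreviation unit_space :: "'g topgroupoid \<Rightarrow> 'g topology" where
  "unit_space G \<equiv> subtopology (top_of G) (units G)"

text \<open>
  The algebraic axioms are Hahn's axioms for a groupoid; they imply that \<open>x\<close> and \<open>y\<close> are
  composable iff \<open>src G x = rng G y\<close>.
\<close>

locale topological_groupoid =
  fixes G :: "'g topgroupoid"
  assumes composable_subset: "composable G \<subseteq> arrows G \<times> arrows G"
    and mul_closed: "(x, y) \<in> composable G \<Longrightarrow> mul G x y \<in> arrows G"
    and ginv_closed: "x \<in> arrows G \<Longrightarrow> ginv G x \<in> arrows G"
    and ginv_ginv: "x \<in> arrows G \<Longrightarrow> ginv G (ginv G x) = x"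
    and composable_assoc:
      "(x, y) \<in> composable G \<Longrightarrow> (y, z) \<in> composable G \<Longrightarrow>
        (mul G x y, z) \<in> composable G \<and> (x, mul G y z) \<in> composable G \<and>
        mul G (mul G x y) z = mul G x (mul G y z)"
    and composable_ginv: "x \<in> arrows G \<Longrightarrow> (x, ginv G x) \<in> composable G"
    and cancel_left: "(x, y) \<in> composable G \<Longrightarrow> mul G (ginv G x) (mul G x y) = y"
    and cancel_right: "(x, y) \<in> composable G \<Longrightarrow> mul G (mul G x y) (ginv G y) = x"
    and continuous_mul:
      "continuous_map (subtopology (prod_topology (top_of G) (top_of G)) (composable G))
        (top_of G) (\<lambda>(x, y). mul G x y)"
    and continuous_ginv: "continuous_map (top_of G) (top_of G) (ginv G)"

definition homeomorphic_onto_open ::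
  "'a topology \<Rightarrow> 'b topology \<Rightarrow> ('a \<Rightarrow> 'b) \<Rightarrow> 'a set \<Rightarrow> bool" where
  "homeomorphic_onto_open X Y f U \<longleftrightarrow>
    openin Y (f ` U) \<and> homeomorphic_map (subtopology X U) (subtopology Y (f ` U)) f"

definition local_homeomorphism :: "'a topology \<Rightarrow> 'b topology \<Rightarrow> ('a \<Rightarrow> 'b) \<Rightarrow> bool" where
  "local_homeomorphism X Y f \<longleftrightarrow>
    (\<forall>x \<in> topspace X. \<exists>U. openin X U \<and> x \<in> U \<and> homeomorphic_onto_open X Y f U)"

text \<open>
  Since inversion is a homeomorphism exchanging \<open>rng G\<close> and \<open>src G\<close>, the source map of an
  etale groupoid is a local homeomorphism as well, and the unit space is automatically open.
\<close>

locale etale_groupoid = topological_groupoid +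
  assumes local_homeomorphism_rng: "local_homeomorphism (top_of G) (unit_space G) (rng G)"

definition open_bisection :: "'g topgroupoid \<Rightarrow> 'g set \<Rightarrow> bool" where
  "open_bisection G U \<longleftrightarrow> openin (top_of G) U \<and>
    homeomorphic_onto_open (top_of G) (unit_space G) (src G) U \<and>
    homeomorphic_onto_open (top_of G) (unit_space G) (rng G) U"

definition compact_open_bisection :: "'g topgroupoid \<Rightarrow> 'g set \<Rightarrow> bool" where
  "compact_open_bisection G U \<longleftrightarrow> compactin (top_of G) U \<and> open_bisection G U"

text \<open>The compact open bisections form a basis of the topology.\<close>

definition ample :: "'g topgroupoid \<Rightarrow> bool" where
  "ample G \<longleftrightarrow> openin (top_of G) = arbitrary union_of (compact_open_bisection G)"

definition arrows_from :: "'g topgroupoid \<Rightarrow> 'g set \<Rightarrow> 'g set" where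
  "arrows_from G D = {x \<in> arrows G. src G x \<in> D}"

text \<open>\<open>subequivalent G K V\<close> is only meant for \<open>K\<close> compact and \<open>V\<close> open in the unit space.\<close>

definition subequivalent :: "'g topgroupoid \<Rightarrow> 'g set \<Rightarrow> 'g set \<Rightarrow> bool" where
  "subequivalent G K V \<longleftrightarrow>
    (\<exists>(n::nat) A. (\<forall>i\<in>{1..n}. open_bisection G (A i)) \<and>
      K \<subseteq> (\<Union>i\<in>{1..n}. src G ` A i) \<and>
      disjoint_family_on (\<lambda>i. rng G ` A i) {1..n} \<and>
      (\<forall>i\<in>{1..n}. rng G ` A i \<subseteq> V))"

definition subequivalent2 :: "'g topgroupoid \<Rightarrow> 'g set \<Rightarrow> 'g set \<Rightarrow> bool" where
  "subequivalent2 G U V \<longleftrightarrow>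
    (\<forall>F. compactin (unit_space G) F \<and> F \<subseteq> U \<longrightarrow>
      (\<exists>O1 O2. openin (unit_space G) O1 \<and> openin (unit_space G) O2 \<and>
        O1 \<noteq> {} \<and> O2 \<noteq> {} \<and> O1 \<inter> O2 = {} \<and> O1 \<subseteq> V \<and> O2 \<subseteq> V \<and>
        subequivalent G F O1 \<and> subequivalent G F O2))"

definition purely_infinite :: "'g topgroupoid \<Rightarrow> bool" where
  "purely_infinite G \<longleftrightarrow>
    (\<forall>O1 O2. openin (unit_space G) O1 \<and> openin (unit_space G) O2 \<and>
      O1 \<noteq> {} \<and> O2 \<noteq> {} \<and> O1 \<subseteq> rng G ` arrows_from G O2 \<longrightarrow>
      subequivalent2 G O1 O2)"

definition matui_purely_infinite :: "'g topgroupoid \<Rightarrow> bool" where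
  "matui_purely_infinite G \<longleftrightarrow>
    (\<forall>W. compactin (unit_space G) W \<and> openin (unit_space G) W \<longrightarrow>
      (\<exists>U V. compact_open_bisection G U \<and> compact_open_bisection G V \<and>
        src G ` U = W \<and> src G ` V = W \<and>
        rng G ` U \<inter> rng G ` V = {} \<and> rng G ` U \<union> rng G ` V \<subseteq> W))"

end

theory Submission
  imports Defs
begin

text \<open>
  In an etale groupoid the open bisections are the open sets on which source and range are
  injective, and they are closed under inverses and products.

  If \<open>G\<close> is purely infinite and \<open>W\<close> is compact open, then \<open>W\<close> is subequivalent to two disjoint
  open subsets of itself; cutting \<open>W\<close> into disjoint compact open pieces subordinate to the
  sources of the bisections involved turns each of the two families into a single compact open
  bisection with source \<open>W\<close>.

  Conversely, a compact \<open>F \<subseteq> O1\<close> is covered by the ranges of finitely many compact open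
  bisections \<open>B\<close> with sources in \<open>O2\<close>. Let \<open>K \<subseteq> O2\<close> be the union of these sources. Iterating
  Matui's condition on \<open>K\<close> yields arbitrarily many bisections with source \<open>K\<close> and with pairwise
  disjoint ranges inside \<open>K\<close>, and composing them with the inverses of the \<open>B\<close> moves \<open>F\<close> into
  \<open>O2\<close> as often as desired.
\<close>

section \<open>Homeomorphisms onto open images and local homeomorphisms\<close>

lemma homeomorphic_onto_openI:
  assumes "continuous_map X Y f" and "open_map X Y f" and "openin X U" and "inj_on f U"
  shows "homeomorphic_onto_open X Y f U"
proof -
  have U: "U \<subseteq> topspace X" using assms(3) openin_subset by blast
  have op: "openin Y (f ` U)" using assms(2,3) by (auto simp: open_map_def)
  then have fU: "f ` U \<subseteq> topspace Y" using openin_subset by blast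
  have "homeomorphic_map (subtopology X U) (subtopology Y (f ` U)) f"
  proof (rule bijective_open_imp_homeomorphic_map)
    show "continuous_map (subtopology X U) (subtopology Y (f ` U)) f"
      using assms(1)
      by (auto simp: continuous_map_in_subtopology continuous_map_from_subtopology)
    show "open_map (subtopology X U) (subtopology Y (f ` U)) f"
      unfolding open_map_def
    proof (intro allI impI)
      fix T assume "openin (subtopology X U) T"
      then have "openin X T" and "T \<subseteq> U"
        using assms(3) by (auto simp: openin_open_subtopology)
      then show "openin (subtopology Y (f ` U)) (f ` T)"
        using assms(2) op by (auto simp: openin_open_subtopology open_map_def)
    qed
    show "f ` topspace (subtopology X U) = topspace (subtopology Y (f ` U))"
      using U fU by auto
    show "inj_on f (topspace (subtopology X U))"
      using assms(4) by (simp add: inj_on_subset)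
  qed
  with op show ?thesis by (simp add: homeomorphic_onto_open_def)
qed

lemma homeomorphic_onto_open_imp_inj_on:
  assumes "homeomorphic_onto_open X Y f U" and "U \<subseteq> topspace X"
  shows "inj_on f U"
  using assms homeomorphic_imp_injective_map
  by (fastforce simp: homeomorphic_onto_open_def Int_absorb1)

text \<open>The inverse is given as a map into \<open>X\<close> itself, ready for composition with
  further maps on \<open>X\<close>.\<close>

lemma homeomorphic_onto_open_inverse:
  assumes "homeomorphic_onto_open X Y f U" and "U \<subseteq> topspace X"
  obtains g where "continuous_map (subtopology Y (f ` U)) X g"
    and "\<And>x. x \<in> U \<Longrightarrow> g (f x) = x"
proof -
  obtain g where g: "homeomorphic_maps (subtopology X U) (subtopology Y (f ` U)) f g"
    using assms(1) by (auto simp: homeomorphic_onto_open_def homeomorphic_map_maps)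
  show thesis
  proof
    show "continuous_map (subtopology Y (f ` U)) X g"
      using g by (auto simp: homeomorphic_maps_def continuous_map_in_subtopology)
    show "g (f x) = x" if "x \<in> U" for x
      using g that assms(2) by (auto simp: homeomorphic_maps_def)
  qed
qed

lemma compactin_vimage_homeomorphic_onto_open:
  assumes "homeomorphic_onto_open X Y f U" and "U \<subseteq> topspace X"
    and "compactin Y D" and "D \<subseteq> f ` U"
  shows "compactin X {x \<in> U. f x \<in> D}"
proof -
  obtain g where g: "continuous_map (subtopology Y (f ` U)) X g"
    and gf: "\<And>x. x \<in> U \<Longrightarrow> g (f x) = x"
    using homeomorphic_onto_open_inverse assms(1,2) by blast
  have "compactin (subtopology Y (f ` U)) D"
    using assms(3,4) by (simp add: compactin_subtopology)
  then have "compactin X (g ` D)" using g image_compactin by blast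
  moreover have "g ` D = {x \<in> U. f x \<in> D}"
    using gf assms(4) by (force simp: image_iff)
  ultimately show ?thesis by simp
qed

lemma local_homeomorphism_imp_open_map:
  assumes "local_homeomorphism X Y f"
  shows "open_map X Y f"
  unfolding open_map_def
proof (intro allI impI)
  fix V assume V: "openin X V"
  show "openin Y (f ` V)"
  proof (subst openin_subopen, intro ballI)
    fix y assume "y \<in> f ` V"
    then obtain x where x: "x \<in> V" "y = f x" by blast
    then have "x \<in> topspace X" using V openin_subset by blast
    then obtain U where U: "openin X U" "x \<in> U" "homeomorphic_onto_open X Y f U"
      using assms by (auto simp: local_homeomorphism_def)
    then have "open_map (subtopology X U) (subtopology Y (f ` U)) f"
      by (simp add: homeomorphic_onto_open_def homeomorphic_imp_open_map)
    moreover have "openin (subtopology X U) (V \<inter> U)"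
      using U V by (auto simp: openin_open_subtopology)
    ultimately have "openin (subtopology Y (f ` U)) (f ` (V \<inter> U))"
      by (simp add: open_map_def)
    then have "openin Y (f ` (V \<inter> U))"
      using U(3) by (meson homeomorphic_onto_open_def openin_trans_full)
    then show "\<exists>T. openin Y T \<and> y \<in> T \<and> T \<subseteq> f ` V"
      using x U by blast
  qed
qed

lemma compactin_diff_openin:
  assumes "compactin X K" and "openin X S"
  shows "compactin X (K - S)"
proof -
  have "K - S = K \<inter> (topspace X - S)"
    using compactin_subset_topspace[OF assms(1)] by blast
  then show ?thesis using assms compact_Int_closedin by (metis closedin_diff closedin_topspace)
qed

section \<open>Products of sets of arrows, and the algebra and continuity of source and
  range\<close>

definition set_inv :: "'g topgroupoid \<Rightarrow> 'g set \<Rightarrow> 'g set" where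
  "set_inv G A = ginv G ` A"

definition set_prod :: "'g topgroupoid \<Rightarrow> 'g set \<Rightarrow> 'g set \<Rightarrow> 'g set" where
  "set_prod G A B = {mul G a b | a b. a \<in> A \<and> b \<in> B \<and> src G a = rng G b}"

context topological_groupoid
begin

lemma ginv_composable: "x \<in> arrows G \<Longrightarrow> (ginv G x, x) \<in> composable G"
  using composable_ginv[of "ginv G x"] ginv_closed ginv_ginv by simp

lemma rng_ginv: "x \<in> arrows G \<Longrightarrow> rng G (ginv G x) = src G x"
  by (simp add: rng_def src_def ginv_ginv)

lemma src_ginv: "x \<in> arrows G \<Longrightarrow> src G (ginv G x) = rng G x"
  by (simp add: rng_def src_def ginv_ginv)

lemma composable_arrows: "(x, y) \<in> composable G \<Longrightarrow> x \<in> arrows G \<and> y \<in> arrows G"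
  using composable_subset by blast

text \<open>Multiplying \<open>x y\<close> by \<open>ginv G y\<close> on the right gives
  \<open>x (rng y) = x\<close>; cancelling \<open>x\<close> on the left turns this into
  \<open>rng y = ginv x x\<close>, which is the source of \<open>x\<close>.\<close>

lemma composable_imp_src_eq_rng:
  assumes "(x, y) \<in> composable G"
  shows "src G x = rng G y"
proof -
  have xy: "x \<in> arrows G" "y \<in> arrows G" using assms composable_arrows by auto
  have "(x, rng G y) \<in> composable G" and "mul G (mul G x y) (ginv G y) = mul G x (rng G y)"
    using composable_assoc[OF assms composable_ginv[OF xy(2)]] by (auto simp: rng_def)
  then have "mul G (ginv G x) x = rng G y"
    using cancel_left[of x "rng G y"] cancel_right[OF assms] by simp
  then show ?thesis by (simp add: src_def)
qed

lemma rng_mul_self: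
  assumes "y \<in> arrows G"
  shows "(rng G y, y) \<in> composable G" and "mul G (rng G y) y = y"
  using composable_assoc[OF composable_ginv[OF assms] ginv_composable[OF assms]]
    cancel_right[OF composable_ginv[OF assms]] ginv_ginv[OF assms]
  by (auto simp: rng_def)

text \<open>For the converse, \<open>x\<close> composes with its source, which is
  \<open>rng G y\<close>, and that unit composes with \<open>y\<close>; associativity joins the two
  pairs.\<close>

lemma composable_iff:
  "(x, y) \<in> composable G \<longleftrightarrow> x \<in> arrows G \<and> y \<in> arrows G \<and> src G x = rng G y"
proof (intro iffI conjI; (elim conjE)?)
  assume x: "x \<in> arrows G" and y: "y \<in> arrows G" and eq: "src G x = rng G y"
  have "(x, rng G y) \<in> composable G"
    using composable_assoc[OF composable_ginv[OF x] ginv_composable[OF x]] eq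
    by (simp add: src_def)
  then show "(x, y) \<in> composable G"
    using composable_assoc rng_mul_self[OF y] by metis
qed (use composable_arrows composable_imp_src_eq_rng in blast)+

text \<open>The product \<open>x y\<close> still composes with \<open>ginv G y\<close>, so its
  source is the range of \<open>ginv G y\<close>.\<close>

lemma src_mul:
  assumes "(x, y) \<in> composable G"
  shows "src G (mul G x y) = src G y"
proof -
  have y: "y \<in> arrows G" using assms composable_arrows by blast
  have "(mul G x y, ginv G y) \<in> composable G"
    using composable_assoc[OF assms composable_ginv[OF y]] by blast
  then show ?thesis using y by (simp add: composable_iff rng_ginv)
qed

lemma rng_mul:
  assumes "(x, y) \<in> composable G"
  shows "rng G (mul G x y) = rng G x"
proof -
  have x: "x \<in> arrows G" using assms composable_arrows by blast
  have "(ginv G x, mul G x y) \<in> composable G"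
    using composable_assoc[OF ginv_composable[OF x] assms] by blast
  then show ?thesis using x by (simp add: composable_iff src_ginv)
qed

lemma src_in_units: "x \<in> arrows G \<Longrightarrow> src G x \<in> units G"
  by (auto simp: units_def src_def)

lemma rng_in_units: "x \<in> arrows G \<Longrightarrow> rng G x \<in> units G"
  by (metis ginv_closed src_ginv src_in_units)

lemma units_subset_arrows: "units G \<subseteq> arrows G"
  using ginv_composable mul_closed by (auto simp: units_def)

lemma topspace_unit_space: "topspace (unit_space G) = units G"
  using units_subset_arrows by auto

lemma src_unit: "u \<in> units G \<Longrightarrow> src G u = u"
  using src_mul ginv_composable by (auto simp: units_def src_def)

lemma rng_unit: "u \<in> units G \<Longrightarrow> rng G u = u"
  using rng_mul ginv_composable rng_ginv by (fastforce simp: units_def src_def)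

lemma continuous_map_rng: "continuous_map (top_of G) (unit_space G) (rng G)"
proof -
  \<comment> \<open>The range map is the pairing of an arrow with its inverse, followed by
    multiplication.\<close>
  have "continuous_map (top_of G)
      (subtopology (prod_topology (top_of G) (top_of G)) (composable G)) (\<lambda>x. (x, ginv G x))"
    using composable_ginv continuous_ginv
    by (auto simp: continuous_map_in_subtopology continuous_map_pairedI)
  from continuous_map_compose[OF this continuous_mul]
  have "continuous_map (top_of G) (top_of G) (rng G)"
    by (simp add: o_def rng_def[abs_def])
  then show ?thesis
    using rng_in_units by (auto simp: continuous_map_in_subtopology)
qed

lemma homeomorphic_map_ginv: "homeomorphic_map (top_of G) (top_of G) (ginv G)"
  unfolding homeomorphic_map_maps homeomorphic_maps_def
  using continuous_ginv ginv_ginv by blast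

lemma continuous_map_src: "continuous_map (top_of G) (unit_space G) (src G)"
  using continuous_map_compose[OF continuous_ginv continuous_map_rng]
  by (rule continuous_map_eq) (simp add: rng_ginv)

end

section \<open>Source and range as open maps; a working form of open bisections\<close>

context etale_groupoid
begin

lemma open_map_rng: "open_map (top_of G) (unit_space G) (rng G)"
  using local_homeomorphism_rng by (rule local_homeomorphism_imp_open_map)

text \<open>Source is range after inversion, and inversion is a homeomorphism.\<close>

lemma open_map_src: "open_map (top_of G) (unit_space G) (src G)"
proof -
  have "src G ` U = rng G ` ginv G ` U" if "openin (top_of G) U" for U
    using openin_subset[OF that] rng_ginv by (force simp: image_image)
  moreover have "open_map (top_of G) (top_of G) (ginv G)"
    using homeomorphic_map_ginv by (rule homeomorphic_imp_open_map)
  ultimately show ?thesis using open_map_rng by (simp add: open_map_def)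
qed

text \<open>Source and range are continuous and open, so on an open set injectivity alone makes them
  homeomorphisms onto open images.\<close>

lemma open_bisection_iff:
  "open_bisection G U \<longleftrightarrow>
    openin (top_of G) U \<and> inj_on (src G) U \<and> inj_on (rng G) U"
  unfolding open_bisection_def
  using homeomorphic_onto_openI[OF continuous_map_src open_map_src]
    homeomorphic_onto_openI[OF continuous_map_rng open_map_rng]
    homeomorphic_onto_open_imp_inj_on[of "top_of G" "unit_space G" _ U] openin_subset
  by metis

lemma open_bisection_subset_arrows: "open_bisection G U \<Longrightarrow> U \<subseteq> arrows G"
  by (simp add: open_bisection_iff openin_subset)

lemma openin_src_image: "open_bisection G U \<Longrightarrow> openin (unit_space G) (src G ` U)"
  using open_map_src by (simp add: open_bisection_iff open_map_def)

lemma openin_rng_image: "open_bisection G U \<Longrightarrow> openin (unit_space G) (rng G ` U)"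
  using open_map_rng by (simp add: open_bisection_iff open_map_def)

section \<open>Inverses, products and disjoint copies of open bisections\<close>

lemma open_bisection_set_inv:
  assumes "open_bisection G A"
  shows "open_bisection G (set_inv G A)"
proof -
  have A: "A \<subseteq> arrows G" "inj_on (src G) A" "inj_on (rng G) A" "openin (top_of G) A"
    using assms by (auto simp: open_bisection_iff openin_subset)
  have "openin (top_of G) (set_inv G A)"
    using homeomorphic_imp_open_map[OF homeomorphic_map_ginv] A(4)
    by (simp add: open_map_def set_inv_def)
  moreover have "inj_on (src G) (set_inv G A)" "inj_on (rng G) (set_inv G A)"
    using A by (auto simp: set_inv_def inj_on_def rng_ginv src_ginv subset_iff)
  ultimately show ?thesis by (simp add: open_bisection_iff)
qed

lemma src_set_inv: "A \<subseteq> arrows G \<Longrightarrow> src G ` set_inv G A = rng G ` A"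
  by (force simp: set_inv_def src_ginv image_iff subset_iff)

lemma rng_set_inv: "A \<subseteq> arrows G \<Longrightarrow> rng G ` set_inv G A = src G ` A"
  by (force simp: set_inv_def rng_ginv image_iff subset_iff)

text \<open>
  With \<open>h\<close> the inverse of \<open>rng\<close> on \<open>A\<close>, the set \<open>A B\<close> consists of the \<open>g\<close> with \<open>rng g \<in> rng ` A\<close>
  and \<open>(h (rng g))\<^sup>-\<^sup>1 g \<in> B\<close>.
\<close>

lemma openin_set_prod:
  assumes A: "open_bisection G A" and B: "openin (top_of G) B"
  shows "openin (top_of G) (set_prod G A B)"
proof -
  have Asub: "A \<subseteq> arrows G" using A by (rule open_bisection_subset_arrows)
  have Bsub: "B \<subseteq> arrows G" using B by (rule openin_subset)
  obtain h where h: "continuous_map (subtopology (unit_space G) (rng G ` A)) (top_of G) h"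
    and hr: "\<And>a. a \<in> A \<Longrightarrow> h (rng G a) = a"
    using homeomorphic_onto_open_inverse[of "top_of G" "unit_space G" "rng G" A] A Asub
    by (auto simp: open_bisection_def)
  define D where "D = {g \<in> arrows G. rng G g \<in> rng G ` A}"
  have D: "openin (top_of G) D"
    using continuous_map_rng openin_rng_image[OF A] unfolding D_def
    by (rule openin_continuous_map_preimage)
  define k where "k g = mul G (ginv G (h (rng G g))) g" for g
  have Dcomp: "(ginv G (h (rng G g)), g) \<in> composable G" if "g \<in> D" for g
    using that Asub hr by (auto simp: D_def composable_iff src_ginv ginv_closed subset_iff)
  have "continuous_map (subtopology (top_of G) D) (subtopology (unit_space G) (rng G ` A)) (rng G)"
    using continuous_map_rng
    by (auto simp: continuous_map_in_subtopology continuous_map_from_subtopology D_def)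
  from continuous_map_compose[OF continuous_map_compose[OF this h] continuous_ginv]
  have c1: "continuous_map (subtopology (top_of G) D) (top_of G) (\<lambda>g. ginv G (h (rng G g)))"
    by (simp add: o_def)
  have "continuous_map (subtopology (top_of G) D)
      (subtopology (prod_topology (top_of G) (top_of G)) (composable G))
      (\<lambda>g. (ginv G (h (rng G g)), g))"
    using c1 Dcomp by (auto simp: continuous_map_in_subtopology intro!: continuous_map_pairedI)
  from continuous_map_compose[OF this continuous_mul]
  have "continuous_map (subtopology (top_of G) D) (top_of G) k"
    by (simp add: o_def k_def[abs_def])
  from openin_continuous_map_preimage[OF this B]
  have "openin (top_of G) {g \<in> topspace (subtopology (top_of G) D). k g \<in> B}"
    using D openin_trans_full by blast
  \<comment> \<open>If \<open>k g \<in> B\<close>, then \<open>g = a (k g)\<close> for the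
    \<open>a \<in> A\<close> with the same range as \<open>g\<close>; conversely
    \<open>k (a b) = b\<close>.\<close>
  moreover have "{g \<in> topspace (subtopology (top_of G) D). k g \<in> B} = set_prod G A B"
  proof (intro equalityI subsetI)
    fix g assume "g \<in> {g \<in> topspace (subtopology (top_of G) D). k g \<in> B}"
    then have g: "g \<in> D" "k g \<in> B" by auto
    then obtain a where a: "a \<in> A" "rng G g = rng G a" by (auto simp: D_def)
    have aarr: "a \<in> arrows G" using a Asub by blast
    have kg: "k g = mul G (ginv G a) g" using a hr by (simp add: k_def)
    have comp: "(ginv G a, g) \<in> composable G" using Dcomp[OF g(1)] a hr by simp
    have "mul G a (k g) = g" using cancel_left[OF comp] aarr by (simp add: kg ginv_ginv)
    moreover have "src G a = rng G (k g)"
      using rng_mul[OF comp] aarr by (simp add: kg rng_ginv)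
    ultimately show "g \<in> set_prod G A B" using a g unfolding set_prod_def by force
  next
    fix g assume "g \<in> set_prod G A B"
    then obtain a b where ab: "g = mul G a b" "a \<in> A" "b \<in> B" "src G a = rng G b"
      by (auto simp: set_prod_def)
    then have comp: "(a, b) \<in> composable G" using Asub Bsub by (auto simp: composable_iff)
    have "g \<in> D" using ab mul_closed[OF comp] rng_mul[OF comp] by (simp add: D_def)
    moreover have "k g = b"
      using ab hr rng_mul[OF comp] cancel_left[OF comp] by (simp add: k_def)
    ultimately show "g \<in> {g \<in> topspace (subtopology (top_of G) D). k g \<in> B}"
      using ab by (auto simp: D_def)
  qed
  ultimately show ?thesis by simp
qed

text \<open>The source of \<open>a b\<close> determines \<open>b\<close>, and then
  \<open>src a = rng b\<close> determines \<open>a\<close>; the range of \<open>a b\<close>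
  determines first \<open>a\<close> and then \<open>b\<close>.\<close>

lemma open_bisection_set_prod:
  assumes A: "open_bisection G A" and B: "open_bisection G B"
  shows "open_bisection G (set_prod G A B)"
proof -
  have sub: "A \<subseteq> arrows G" "B \<subseteq> arrows G" using A B open_bisection_subset_arrows by auto
  have inj: "inj_on (src G) A" "inj_on (rng G) A" "inj_on (src G) B" "inj_on (rng G) B"
    using A B by (auto simp: open_bisection_iff)
  have comp: "(a, b) \<in> composable G" if "a \<in> A" "b \<in> B" "src G a = rng G b" for a b
    using that sub by (auto simp: composable_iff)
  have "inj_on (src G) (set_prod G A B)"
  proof (rule inj_onI)
    fix x y assume "x \<in> set_prod G A B" "y \<in> set_prod G A B" "src G x = src G y"
    then obtain a b c d where "x = mul G a b" "a \<in> A" "b \<in> B" "src G a = rng G b"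
      "y = mul G c d" "c \<in> A" "d \<in> B" "src G c = rng G d" "src G x = src G y"
      by (auto simp: set_prod_def)
    then show "x = y" using src_mul[OF comp] inj by (metis inj_onD)
  qed
  moreover have "inj_on (rng G) (set_prod G A B)"
  proof (rule inj_onI)
    fix x y assume "x \<in> set_prod G A B" "y \<in> set_prod G A B" "rng G x = rng G y"
    then obtain a b c d where "x = mul G a b" "a \<in> A" "b \<in> B" "src G a = rng G b"
      "y = mul G c d" "c \<in> A" "d \<in> B" "src G c = rng G d" "rng G x = rng G y"
      by (auto simp: set_prod_def)
    then show "x = y" using rng_mul[OF comp] inj by (metis inj_onD)
  qed
  ultimately show ?thesis
    using openin_set_prod[OF A] B by (simp add: open_bisection_iff)
qed

text \<open>The inclusion of \<open>rng G\<close> B\<open>in\<close>src G \<open>A\<close> gives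
  every \<open>b \<in> B\<close> a composable partner in \<open>A\<close>, so no source is
  lost.\<close>

lemma src_set_prod:
  assumes "A \<subseteq> arrows G" and "B \<subseteq> arrows G" and "rng G ` B \<subseteq> src G ` A"
  shows "src G ` set_prod G A B = src G ` B"
proof (intro equalityI subsetI)
  fix u assume "u \<in> src G ` B"
  then obtain b where b: "b \<in> B" "u = src G b" by blast
  then obtain a where a: "a \<in> A" "src G a = rng G b" using assms(3) by force
  then have "src G (mul G a b) = u"
    using b assms by (auto simp: composable_iff subset_iff intro!: src_mul)
  then show "u \<in> src G ` set_prod G A B"
    using a b unfolding set_prod_def by blast
next
  fix u assume "u \<in> src G ` set_prod G A B"
  then show "u \<in> src G ` B"
    using assms(1,2) src_mul by (fastforce simp: set_prod_def composable_iff)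
qed

lemma rng_set_prod_subset:
  assumes "A \<subseteq> arrows G" and "B \<subseteq> arrows G"
  shows "rng G ` set_prod G A B \<subseteq> rng G ` A"
  using assms rng_mul by (fastforce simp: set_prod_def composable_iff)

text \<open>Products with equal ranges share their left factor \<open>a\<close>, because range is
  injective on \<open>A\<close>; both right factors then have range \<open>src G a\<close>.\<close>

lemma rng_set_prod_disjoint:
  assumes A: "open_bisection G A" and B: "B \<subseteq> arrows G" and C: "C \<subseteq> arrows G"
    and disj: "rng G ` B \<inter> rng G ` C = {}"
  shows "rng G ` set_prod G A B \<inter> rng G ` set_prod G A C = {}"
proof -
  have sub: "A \<subseteq> arrows G" using A by (rule open_bisection_subset_arrows)
  have inj: "inj_on (rng G) A" using A by (simp add: open_bisection_iff)
  have False if "a \<in> A" "b \<in> B" "src G a = rng G b" "a' \<in> A" "c \<in> C" "src G a' = rng G c"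
    "rng G (mul G a b) = rng G (mul G a' c)" for a b a' c
  proof -
    have "(a, b) \<in> composable G" "(a', c) \<in> composable G"
      using that sub B C by (auto simp: composable_iff)
    then have "a = a'" using that inj rng_mul by (metis inj_onD)
    then show False using that disj by (metis disjoint_iff imageI)
  qed
  then show ?thesis by (fastforce simp: set_prod_def)
qed

text \<open>Frees the index set from the form \<open>{1..n}\<close>, so that a family can be indexed
  by a finite set of bisections.\<close>

lemma subequivalentI_finite:
  assumes "finite I" and "\<And>i. i \<in> I \<Longrightarrow> open_bisection G (A i)"
    and "K \<subseteq> (\<Union>i\<in>I. src G ` A i)" and "disjoint_family_on (\<lambda>i. rng G ` A i) I"
    and "\<And>i. i \<in> I \<Longrightarrow> rng G ` A i \<subseteq> V"
  shows "subequivalent G K V"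
proof -
  obtain e where e: "bij_betw e {1..card I} I"
    using ex_bij_betw_nat_finite_1[OF assms(1)] by blast
  have eI: "e i \<in> I" if "i \<in> {1..card I}" for i using e that by (meson bij_betwE)
  have "(\<Union>i\<in>e ` {1..card I}. src G ` A i) = (\<Union>i\<in>{1..card I}. src G ` A (e i))"
    by simp
  then have "(\<Union>i\<in>I. src G ` A i) = (\<Union>i\<in>{1..card I}. src G ` A (e i))"
    unfolding bij_betw_imp_surj_on[OF e] .
  moreover have "disjoint_family_on (\<lambda>i. rng G ` A (e i)) {1..card I}"
    unfolding disjoint_family_on_def
  proof (intro ballI impI)
    fix i j assume ij: "i \<in> {1..card I}" "j \<in> {1..card I}" "i \<noteq> j"
    then have "e i \<noteq> e j" using e by (meson bij_betw_imp_inj_on inj_onD)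
    then show "rng G ` A (e i) \<inter> rng G ` A (e j) = {}"
      using assms(4) eI ij by (auto simp: disjoint_family_on_def)
  qed
  ultimately show ?thesis
    unfolding subequivalent_def using assms(2,3,5) eI
    by (intro exI[of _ "card I"] exI[of _ "\<lambda>i. A (e i)"]) auto
qed

text \<open>\<open>U\<close> and \<open>V\<close> copy \<open>K\<close> to two disjoint places
  inside \<open>K\<close>, and the place of \<open>V\<close> has room for all copies made so far;
  hence induction on the index set. Any finite \<open>I\<close> is allowed, so that copies can be
  labelled by pairs.\<close>

lemma disjoint_copies:
  assumes U: "open_bisection G U" and V: "open_bisection G V"
    and src: "src G ` U = K" "src G ` V = K"
    and disj: "rng G ` U \<inter> rng G ` V = {}" and rng: "rng G ` U \<union> rng G ` V \<subseteq> K"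
    and "finite I"
  shows "\<exists>A. (\<forall>i\<in>I. open_bisection G (A i) \<and> src G ` A i = K \<and> rng G ` A i \<subseteq> K) \<and>
    disjoint_family_on (\<lambda>i. rng G ` A i) I"
  using \<open>finite I\<close>
proof (induction I)
  case empty
  then show ?case by (simp add: disjoint_family_on_def)
next
  case (insert j I)
  then obtain A where A: "\<And>i. i \<in> I \<Longrightarrow> open_bisection G (A i)"
    "\<And>i. i \<in> I \<Longrightarrow> src G ` A i = K" "\<And>i. i \<in> I \<Longrightarrow> rng G ` A i \<subseteq> K"
    and Ad: "disjoint_family_on (\<lambda>i. rng G ` A i) I"
    by blast
  define B where "B i = (if i = j then U else set_prod G V (A i))" for i
  have Bj: "B j = U" by (simp add: B_def)
  have BI: "B i = set_prod G V (A i)" if "i \<in> I" for i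
    using that insert.hyps by (auto simp: B_def)
  have Vs: "V \<subseteq> arrows G" and As: "\<And>i. i \<in> I \<Longrightarrow> A i \<subseteq> arrows G"
    using V A(1) open_bisection_subset_arrows by auto
  have rV: "rng G ` B i \<subseteq> rng G ` V" if "i \<in> I" for i
    using rng_set_prod_subset[OF Vs As] that by (simp add: BI)
  have "open_bisection G (B i) \<and> src G ` B i = K \<and> rng G ` B i \<subseteq> K" if "i \<in> I" for i
  proof (intro conjI)
    show "open_bisection G (B i)"
      using that open_bisection_set_prod[OF V A(1)] by (simp add: BI)
    show "src G ` B i = K"
      using that src_set_prod[OF Vs As] A(2,3) src by (simp add: BI)
    show "rng G ` B i \<subseteq> K" using rV[OF that] rng by blast
  qed
  moreover have "disjoint_family_on (\<lambda>i. rng G ` B i) (insert j I)"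
    unfolding disjoint_family_on_insert[OF insert.hyps(2)]
  proof
    show "rng G ` B j \<inter> (\<Union>i\<in>I. rng G ` B i) = {}"
      using disj rV unfolding Bj by blast
    show "disjoint_family_on (\<lambda>i. rng G ` B i) I"
      using Ad rng_set_prod_disjoint[OF V As As] by (auto simp: disjoint_family_on_def BI)
  qed
  ultimately show ?case
    using U src rng Bj by (intro exI[of _ B]) auto
qed

end

section \<open>Compact open sets and compact open bisections in an ample Hausdorff groupoid\<close>

locale ample_groupoid = etale_groupoid +
  assumes is_ample: "ample G"
    and Hausdorff: "Hausdorff_space (top_of G)"
begin

lemma compact_open_bisection_basis:
  assumes "openin (top_of G) N" and "x \<in> N"
  obtains B where "compact_open_bisection G B" and "x \<in> B" and "B \<subseteq> N"
proof -
  have "(arbitrary union_of (compact_open_bisection G)) N"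
    using assms(1) is_ample by (simp add: ample_def)
  then show thesis using that assms(2) by (auto simp: union_of_def)
qed

lemma compactin_src_image: "compact_open_bisection G B \<Longrightarrow> compactin (unit_space G) (src G ` B)"
  using continuous_map_src image_compactin by (auto simp: compact_open_bisection_def)

text \<open>A unit is its own source and range, so a small basic bisection around it serves. Its
  source is a compact open neighbourhood of \<open>u\<close> inside \<open>N\<close>.\<close>

lemma compact_open_bisection_at_unit:
  assumes "openin (unit_space G) N" and "u \<in> N"
  obtains B where "compact_open_bisection G B" and "u \<in> src G ` B" and "u \<in> rng G ` B"
    and "src G ` B \<subseteq> N"
proof -
  have u: "u \<in> units G" using assms openin_subset topspace_unit_space by blast
  have "openin (top_of G) {x \<in> arrows G. src G x \<in> N}"
    using continuous_map_src assms(1) by (rule openin_continuous_map_preimage)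
  then obtain B where "compact_open_bisection G B" "u \<in> B" "B \<subseteq> {x \<in> arrows G. src G x \<in> N}"
    using compact_open_bisection_basis assms(2) u units_subset_arrows src_unit
    by (metis (no_types, lifting) mem_Collect_eq subsetD)
  moreover from this have "u \<in> src G ` B" "u \<in> rng G ` B"
    using src_unit[OF u] rng_unit[OF u] by (metis imageI)+
  ultimately show thesis by (intro that[of B]) auto
qed

text \<open>\<open>Q\<close> is a union of compact open sets, namely sources of bisections; finitely
  many of them cover \<open>C\<close>.\<close>

lemma compact_open_between:
  assumes C: "compactin (unit_space G) C" and Q: "openin (unit_space G) Q" and "C \<subseteq> Q"
  obtains W where "compactin (unit_space G) W" and "openin (unit_space G) W"
    and "C \<subseteq> W" and "W \<subseteq> Q"
proof -
  define \<U> where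
    "\<U> = {S. compactin (unit_space G) S \<and> openin (unit_space G) S \<and> S \<subseteq> Q}"
  have "C \<subseteq> \<Union>\<U>"
  proof
    fix u assume "u \<in> C"
    then obtain B where B: "compact_open_bisection G B" "u \<in> src G ` B" "src G ` B \<subseteq> Q"
      using compact_open_bisection_at_unit[OF Q] assms(3) by blast
    then have "src G ` B \<in> \<U>"
      using compactin_src_image openin_src_image by (auto simp: \<U>_def compact_open_bisection_def)
    with B show "u \<in> \<Union>\<U>" by blast
  qed
  then obtain \<F> where \<F>: "finite \<F>" "\<F> \<subseteq> \<U>" "C \<subseteq> \<Union>\<F>"
    using compactinD[OF C, of \<U>] by (auto simp: \<U>_def)
  show thesis
  proof
    show "compactin (unit_space G) (\<Union>\<F>)"
      using \<F> by (intro compactin_Union) (auto simp: \<U>_def)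
    show "openin (unit_space G) (\<Union>\<F>)"
      using \<F> by (intro openin_Union) (auto simp: \<U>_def)
  qed (use \<F> in \<open>auto simp: \<U>_def\<close>)
qed

lemma Hausdorff_unit_space: "Hausdorff_space (unit_space G)"
  using Hausdorff by (rule Hausdorff_space_subtopology)

text \<open>Compactness holds because source maps the restricted set homeomorphically onto
  \<open>D\<close>.\<close>

lemma compact_open_bisection_restrict:
  assumes A: "open_bisection G A" and "compactin (unit_space G) D"
    and "openin (unit_space G) D" and "D \<subseteq> src G ` A"
  shows "compact_open_bisection G {x \<in> A. src G x \<in> D}"
proof -
  have sub: "A \<subseteq> arrows G" using A by (rule open_bisection_subset_arrows)
  have "openin (top_of G) {x \<in> arrows G. src G x \<in> D}"
    using continuous_map_src assms(3) by (rule openin_continuous_map_preimage)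
  then have "openin (top_of G) (A \<inter> {x \<in> arrows G. src G x \<in> D})"
    using A by (auto simp: open_bisection_iff)
  moreover have "A \<inter> {x \<in> arrows G. src G x \<in> D} = {x \<in> A. src G x \<in> D}"
    using sub by blast
  ultimately have "openin (top_of G) {x \<in> A. src G x \<in> D}" by simp
  then have "open_bisection G {x \<in> A. src G x \<in> D}"
    using A by (auto simp: open_bisection_iff inj_on_def)
  moreover have "compactin (top_of G) {x \<in> A. src G x \<in> D}"
    using A sub assms(2,4)
    by (intro compactin_vimage_homeomorphic_onto_open) (auto simp: open_bisection_def)
  ultimately show ?thesis by (simp add: compact_open_bisection_def)
qed

lemma compact_open_bisection_Un:
  assumes A: "compact_open_bisection G A" and B: "compact_open_bisection G B"
    and "src G ` A \<inter> src G ` B = {}" and "rng G ` A \<inter> rng G ` B = {}"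
  shows "compact_open_bisection G (A \<union> B)"
  using assms
  by (auto simp: compact_open_bisection_def open_bisection_iff inj_on_Un compactin_Un)

text \<open>The ranges are disjoint but the sources may overlap. Restricting each \<open>A i\<close>
  to its own piece of a partition of \<open>W\<close> makes the sources disjoint too, and then the
  union is injective under both maps.\<close>

lemma glue_compact_open_bisections:
  assumes "finite I" and "\<And>i. i \<in> I \<Longrightarrow> open_bisection G (A i)"
    and "disjoint_family_on (\<lambda>i. rng G ` A i) I"
    and "compactin (unit_space G) W" and "openin (unit_space G) W"
    and "W \<subseteq> (\<Union>i\<in>I. src G ` A i)"
  shows "\<exists>U. compact_open_bisection G U \<and> src G ` U = W \<and>
    rng G ` U \<subseteq> (\<Union>i\<in>I. rng G ` A i)"
  using assms
proof (induction I arbitrary: W rule: finite_induct)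
  case empty
  have "compact_open_bisection G {}"
    by (simp add: compact_open_bisection_def open_bisection_iff)
  then show ?case using empty by (intro exI[of _ "{}"]) simp
next
  case (insert j I)
  let ?Q = "W \<inter> (\<Union>i\<in>I. src G ` A i)"
  have Aj: "open_bisection G (A j)" using insert.prems by simp
  have disj: "rng G ` A j \<inter> (\<Union>i\<in>I. rng G ` A i) = {}" "disjoint_family_on (\<lambda>i. rng G ` A i) I"
    using insert.prems(2) insert.hyps(2) by (auto simp: disjoint_family_on_insert)
  have "compactin (unit_space G) (W - src G ` A j)"
    using insert.prems(3) openin_src_image[OF Aj] by (rule compactin_diff_openin)
  moreover have "openin (unit_space G) ?Q"
    using insert.prems(1,4) openin_src_image by blast
  moreover have "W - src G ` A j \<subseteq> ?Q" using insert.prems(5) by blast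
  ultimately obtain W' where W': "compactin (unit_space G) W'" "openin (unit_space G) W'"
    "W - src G ` A j \<subseteq> W'" "W' \<subseteq> ?Q"
    by (rule compact_open_between)
  obtain U where U: "compact_open_bisection G U" "src G ` U = W'"
    "rng G ` U \<subseteq> (\<Union>i\<in>I. rng G ` A i)"
    using insert.IH[of W'] insert.prems(1) disj(2) W' by auto
  \<comment> \<open>In a Hausdorff space the compact set \<open>W'\<close> is closed, so the
    remainder is open as well as compact.\<close>
  have opW: "openin (unit_space G) (W - W')"
    using insert.prems(4) compactin_imp_closedin[OF Hausdorff_unit_space W'(1)]
    by (rule openin_diff)
  have "compactin (unit_space G) (W - W')"
    using insert.prems(3) W'(2) by (rule compactin_diff_openin)
  moreover have D: "W - W' \<subseteq> src G ` A j" using W'(3) by blast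
  ultimately have R: "compact_open_bisection G {x \<in> A j. src G x \<in> W - W'}"
    using compact_open_bisection_restrict[OF Aj] opW by blast
  have sR: "src G ` {x \<in> A j. src G x \<in> W - W'} = W - W'" using D by blast
  have rR: "rng G ` {x \<in> A j. src G x \<in> W - W'} \<subseteq> rng G ` A j" by blast
  have "compact_open_bisection G (U \<union> {x \<in> A j. src G x \<in> W - W'})"
  proof (rule compact_open_bisection_Un[OF U(1) R])
    show "src G ` U \<inter> src G ` {x \<in> A j. src G x \<in> W - W'} = {}"
      unfolding U(2) sR by blast
    show "rng G ` U \<inter> rng G ` {x \<in> A j. src G x \<in> W - W'} = {}"
      using U(3) rR disj(1) by blast
  qed
  moreover have "src G ` (U \<union> {x \<in> A j. src G x \<in> W - W'}) = W"
    unfolding image_Un U(2) sR using W'(4) by blast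
  moreover have "rng G ` (U \<union> {x \<in> A j. src G x \<in> W - W'}) \<subseteq> (\<Union>i\<in>insert j I. rng G ` A i)"
    unfolding image_Un UN_insert using U(3) rR by (simp add: le_supI1 le_supI2)
  ultimately show ?case by (intro exI[of _ "U \<union> {x \<in> A j. src G x \<in> W - W'}"] conjI)
qed

lemma subequivalent_imp_compact_open_bisection:
  assumes "subequivalent G W V" and "compactin (unit_space G) W" and "openin (unit_space G) W"
  obtains U where "compact_open_bisection G U" and "src G ` U = W" and "rng G ` U \<subseteq> V"
proof -
  obtain n :: nat and A where A: "\<forall>i\<in>{1..n}. open_bisection G (A i)"
    "W \<subseteq> (\<Union>i\<in>{1..n}. src G ` A i)" "disjoint_family_on (\<lambda>i. rng G ` A i) {1..n}"
    "\<forall>i\<in>{1..n}. rng G ` A i \<subseteq> V"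
    using assms(1) by (auto simp: subequivalent_def)
  have "\<exists>U. compact_open_bisection G U \<and> src G ` U = W \<and>
      rng G ` U \<subseteq> (\<Union>i\<in>{1..n}. rng G ` A i)"
    using A(1) by (intro glue_compact_open_bisections A(2,3) assms(2,3)) simp_all
  moreover have "(\<Union>i\<in>{1..n}. rng G ` A i) \<subseteq> V" using A(4) by (intro UN_least) simp
  ultimately show thesis using that by (elim exE conjE) (metis order_trans)
qed

section \<open>From pure infiniteness to Matui's condition\<close>

lemma purely_infinite_imp_matui:
  assumes "purely_infinite G"
  shows "matui_purely_infinite G"
  unfolding matui_purely_infinite_def
proof (intro allI impI, elim conjE)
  fix W assume W: "compactin (unit_space G) W" "openin (unit_space G) W"
  show "\<exists>U V. compact_open_bisection G U \<and> compact_open_bisection G V \<and>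
        src G ` U = W \<and> src G ` V = W \<and>
        rng G ` U \<inter> rng G ` V = {} \<and> rng G ` U \<union> rng G ` V \<subseteq> W"
  \<comment> \<open>Pure infiniteness speaks of non-empty sets only; for the empty set the empty
    bisection works.\<close>
  proof (cases "W = {}")
    case True
    have "compact_open_bisection G {}"
      by (simp add: compact_open_bisection_def open_bisection_iff)
    then show ?thesis using True by (intro exI[of _ "{}"]) simp
  next
    case False
    have "W \<subseteq> rng G ` arrows_from G W"
    proof
      fix u assume "u \<in> W"
      moreover from this have "u \<in> units G"
        using W openin_subset topspace_unit_space by blast
      ultimately show "u \<in> rng G ` arrows_from G W"
        using units_subset_arrows
        by (intro image_eqI[of _ _ u]) (auto simp: arrows_from_def rng_unit src_unit)
    qed
    then have "subequivalent2 G W W"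
      using assms W False by (simp add: purely_infinite_def)
    \<comment> \<open>\<open>W\<close> is compact, so it may itself be taken as the compact subset
      \<open>F\<close>.\<close>
    then obtain O1 O2 where O12: "O1 \<inter> O2 = {}" "O1 \<subseteq> W" "O2 \<subseteq> W"
      "subequivalent G W O1" "subequivalent G W O2"
      using W(1) by (auto simp: subequivalent2_def dest!: spec[of _ W])
    obtain U where "compact_open_bisection G U" "src G ` U = W" "rng G ` U \<subseteq> O1"
      using subequivalent_imp_compact_open_bisection[OF O12(4) W] .
    moreover obtain V where "compact_open_bisection G V" "src G ` V = W" "rng G ` V \<subseteq> O2"
      using subequivalent_imp_compact_open_bisection[OF O12(5) W] .
    ultimately show ?thesis using O12(1-3) by (intro exI[of _ U] exI[of _ V]) auto
  qed
qed

section \<open>From Matui's condition to pure infiniteness\<close>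

lemma cover_by_bisections:
  assumes F: "compactin (unit_space G) F" and P: "openin (unit_space G) P"
    and "F \<subseteq> rng G ` arrows_from G P"
  obtains \<B> where "finite \<B>" and "\<forall>B\<in>\<B>. compact_open_bisection G B"
    and "\<forall>B\<in>\<B>. src G ` B \<subseteq> P" and "F \<subseteq> (\<Union>B\<in>\<B>. rng G ` B)"
proof -
  define \<U> where "\<U> = {B. compact_open_bisection G B \<and> src G ` B \<subseteq> P}"
  have op: "openin (top_of G) (arrows_from G P)"
    using continuous_map_src P unfolding arrows_from_def
    by (rule openin_continuous_map_preimage)
  \<comment> \<open>Every arrow of the open set \<open>arrows_from G P\<close> lies in a compact
    open bisection inside it, and the ranges of these bisections are open.\<close>
  have "F \<subseteq> \<Union>((`) (rng G) ` \<U>)"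
  proof
    fix u assume "u \<in> F"
    then obtain x where x: "x \<in> arrows_from G P" "u = rng G x" using assms(3) by blast
    obtain B where "compact_open_bisection G B" "x \<in> B" "B \<subseteq> arrows_from G P"
      using compact_open_bisection_basis[OF op x(1)] by blast
    moreover from this have "B \<in> \<U>" by (auto simp: \<U>_def arrows_from_def)
    ultimately show "u \<in> \<Union>((`) (rng G) ` \<U>)" using x by blast
  qed
  moreover have "openin (unit_space G) S" if "S \<in> (`) (rng G) ` \<U>" for S
    using that openin_rng_image by (auto simp: \<U>_def compact_open_bisection_def)
  ultimately obtain \<F> where \<F>: "finite \<F>" "\<F> \<subseteq> (`) (rng G) ` \<U>" "F \<subseteq> \<Union>\<F>"
    using compactinD[OF F, of "(`) (rng G) ` \<U>"] by blast
  from finite_subset_image[OF \<F>(1,2)] obtain \<B> where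
    "\<B> \<subseteq> \<U>" "finite \<B>" "\<F> = (`) (rng G) ` \<B>" by blast
  then show thesis using \<F>(3) by (intro that[of \<B>]) (auto simp: \<U>_def)
qed

lemma matui_imp_subequivalent2:
  assumes matui: "matui_purely_infinite G"
    and P: "openin (unit_space G) P" "P \<noteq> {}" and "Q \<subseteq> rng G ` arrows_from G P"
  shows "subequivalent2 G Q P"
  unfolding subequivalent2_def
proof (intro allI impI, elim conjE)
  fix F assume F: "compactin (unit_space G) F" "F \<subseteq> Q"
  obtain \<C> where \<C>: "finite \<C>" "\<forall>B\<in>\<C>. compact_open_bisection G B"
    "\<forall>B\<in>\<C>. src G ` B \<subseteq> P" "F \<subseteq> (\<Union>B\<in>\<C>. rng G ` B)"
    by (rule cover_by_bisections[OF F(1) P(1) order_trans[OF F(2) assms(4)]])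
  \<comment> \<open>\<open>B0\<close> is adjoined to the cover to keep \<open>K\<close>, and with it
    both target sets, non-empty even if \<open>F\<close> is empty.\<close>
  obtain u where "u \<in> P" using P(2) by blast
  from compact_open_bisection_at_unit[OF P(1) this] obtain B0 where
    B0: "compact_open_bisection G B0" "src G ` B0 \<noteq> {}" "src G ` B0 \<subseteq> P"
    by (metis empty_iff)
  define \<B> where "\<B> = insert B0 \<C>"
  have \<B>: "finite \<B>" "\<And>B. B \<in> \<B> \<Longrightarrow> compact_open_bisection G B"
    "\<And>B. B \<in> \<B> \<Longrightarrow> src G ` B \<subseteq> P" "F \<subseteq> (\<Union>B\<in>\<B>. rng G ` B)"
    using \<C> B0 by (auto simp: \<B>_def)
  \<comment> \<open>Collecting all sources gives one compact open domain, to which Matui's condition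
    applies and through which every \<open>B\<close> can be routed.\<close>
  define K where "K = (\<Union>B\<in>\<B>. src G ` B)"
  have "compactin (unit_space G) K"
    unfolding K_def using \<B>(1,2) compactin_src_image by (intro compactin_Union) auto
  moreover have "openin (unit_space G) K"
    unfolding K_def using \<B>(2) openin_src_image
    by (intro openin_Union) (auto simp: compact_open_bisection_def)
  ultimately obtain U V where UV: "compact_open_bisection G U" "compact_open_bisection G V"
    "src G ` U = K" "src G ` V = K" "rng G ` U \<inter> rng G ` V = {}" "rng G ` U \<union> rng G ` V \<subseteq> K"
    using matui by (auto simp: matui_purely_infinite_def dest!: spec[of _ K])
  \<comment> \<open>Each \<open>B\<close> needs one copy of \<open>K\<close> for each of the two
    target sets; the boolean names the target, and \<open>R True\<close> and \<open>R False\<close>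
    become \<open>O1\<close> and \<open>O2\<close>.\<close>
  have "finite (\<B> \<times> (UNIV :: bool set))" using \<B>(1) by simp
  from disjoint_copies[OF _ _ UV(3-6) this] obtain A where
    copies: "\<forall>i\<in>\<B> \<times> (UNIV :: bool set).
      open_bisection G (A i) \<and> src G ` A i = K \<and> rng G ` A i \<subseteq> K"
    and Ad: "disjoint_family_on (\<lambda>i. rng G ` A i) (\<B> \<times> (UNIV :: bool set))"
    using UV(1,2) by (auto simp: compact_open_bisection_def)
  have A: "\<And>B b. B \<in> \<B> \<Longrightarrow> open_bisection G (A (B, b))"
    "\<And>B b. B \<in> \<B> \<Longrightarrow> src G ` A (B, b) = K" "\<And>B b. B \<in> \<B> \<Longrightarrow> rng G ` A (B, b) \<subseteq> K"
    using copies by simp_all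
  define R where "R b = (\<Union>B\<in>\<B>. rng G ` A (B, b))" for b
  have KP: "K \<subseteq> P" using \<B>(3) by (auto simp: K_def)
  have Kne: "K \<noteq> {}" using B0 by (auto simp: K_def \<B>_def)
  have Rop: "openin (unit_space G) (R b)" for b
    unfolding R_def using A(1) openin_rng_image by blast
  have Rne: "R b \<noteq> {}" for b
    using A(2)[of B0 b] Kne by (auto simp: R_def \<B>_def)
  have RP: "R b \<subseteq> P" for b using A(3) KP by (force simp: R_def)
  have Rd: "R True \<inter> R False = {}"
  proof -
    have "rng G ` A (B, True) \<inter> rng G ` A (C, False) = {}" if "B \<in> \<B>" "C \<in> \<B>" for B C
      using Ad that by (auto simp: disjoint_family_on_def)
    then show ?thesis unfolding R_def by blast
  qed
  have "subequivalent G F (R b)" for b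
  proof (rule subequivalentI_finite[OF \<B>(1), where A = "\<lambda>B. set_prod G (A (B, b)) (set_inv G B)"])
    have ob: "open_bisection G B" if "B \<in> \<B>" for B
      using \<B>(2) that by (simp add: compact_open_bisection_def)
    then have sub: "B \<subseteq> arrows G" "A (B, b) \<subseteq> arrows G" "set_inv G B \<subseteq> arrows G" if "B \<in> \<B>" for B
      using that A(1) open_bisection_set_inv open_bisection_subset_arrows by blast+
    show "open_bisection G (set_prod G (A (B, b)) (set_inv G B))" if "B \<in> \<B>" for B
      using that A(1) ob by (simp add: open_bisection_set_prod open_bisection_set_inv)
    have "src G ` set_prod G (A (B, b)) (set_inv G B) = rng G ` B" if "B \<in> \<B>" for B
    proof -
      have "rng G ` set_inv G B \<subseteq> src G ` A (B, b)"
        using that sub A(2) by (auto simp: rng_set_inv K_def)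
      then show ?thesis using that sub by (simp add: src_set_prod src_set_inv)
    qed
    then show "F \<subseteq> (\<Union>B\<in>\<B>. src G ` set_prod G (A (B, b)) (set_inv G B))"
      using \<B>(4) by simp
    have rsub: "rng G ` set_prod G (A (B, b)) (set_inv G B) \<subseteq> rng G ` A (B, b)" if "B \<in> \<B>" for B
      using that sub by (simp add: rng_set_prod_subset)
    then show "rng G ` set_prod G (A (B, b)) (set_inv G B) \<subseteq> R b" if "B \<in> \<B>" for B
      using that unfolding R_def by blast
    show "disjoint_family_on (\<lambda>B. rng G ` set_prod G (A (B, b)) (set_inv G B)) \<B>"
      unfolding disjoint_family_on_def
    proof (intro ballI impI)
      fix B C assume BC: "B \<in> \<B>" "C \<in> \<B>" "B \<noteq> C"
      then have "rng G ` A (B, b) \<inter> rng G ` A (C, b) = {}"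
        using Ad by (auto simp: disjoint_family_on_def)
      then show "rng G ` set_prod G (A (B, b)) (set_inv G B) \<inter>
          rng G ` set_prod G (A (C, b)) (set_inv G C) = {}"
        using rsub[OF BC(1)] rsub[OF BC(2)] by blast
    qed
  qed
  then show "\<exists>O1 O2. openin (unit_space G) O1 \<and> openin (unit_space G) O2 \<and>
        O1 \<noteq> {} \<and> O2 \<noteq> {} \<and> O1 \<inter> O2 = {} \<and> O1 \<subseteq> P \<and> O2 \<subseteq> P \<and>
        subequivalent G F O1 \<and> subequivalent G F O2"
    using Rop Rne RP Rd by (intro exI[of _ "R True"] exI[of _ "R False"]) simp
qed

end

theorem corollary5p5:
  fixes G :: "'g topgroupoid"
  assumes "etale_groupoid G"
    and "locally_compact_space (top_of G)"
    and "Hausdorff_space (top_of G)"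
    and "ample G"
    and "infinite (units G)"
  shows "purely_infinite G \<longleftrightarrow> matui_purely_infinite G"
proof -
  interpret ample_groupoid G
    using assms by (simp add: ample_groupoid_def ample_groupoid_axioms_def)
  show ?thesis
  proof
    show "matui_purely_infinite G" if "purely_infinite G"
      using that by (rule purely_infinite_imp_matui)
    show "purely_infinite G" if "matui_purely_infinite G"
      using that matui_imp_subequivalent2 by (simp add: purely_infinite_def)
  qed
qed

end
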